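(* Assume the axiom of choice. Let $(K,\tau)$ be a compact Hausdorff topological space. If every subset of $K$ is a Borel set, i.e. $\operatorname{Bo}(K,\tau)=P(K)$, then $K$ is scattered.
   Context: $\operatorname{Bo}(T,\tau)$ denotes the Borel $\sigma$-algebra on a set $T$ generated by a topology $\tau$ on $T$, and $P(X)$ denotes the power set of $X$. A topological space is scattered if every non-empty subset $A$ of it has a point that is isolated in the subspace topology of $A$. *)

theory Defs
  imports "HOL-Analysis.Analysis"
begin

text \<open>
  The library constant \<open>borel\<close> and the predicate \<open>isolated_in\<close> only
  cover topological spaces given by a type class; the following are the counterparts for an
  arbitrary space \<open>X :: 'a topology\<close>.
\<close>

definition Borel_sets_of :: "'a topology \<Rightarrow> 'a set set"
  where "Borel_sets_of X = sigma_sets (topspace X) {U. openin X U}"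

definition scattered_space :: "'a topology \<Rightarrow> bool"
  where "scattered_space X \<longleftrightarrow>
    (\<forall>A. A \<subseteq> topspace X \<and> A \<noteq> {} \<longrightarrow> (\<exists>x\<in>A. openin (subtopology X A) {x}))"

end

theory Submission
  imports Defs
begin

text \<open>
  A compact Hausdorff space \<open>K\<close> that is not scattered carries a Cantor scheme of closed sets and
  hence, by Urysohn's lemma, a continuous map \<open>f\<close> onto (a superset of) \<open>[0,1]\<close>. By Zorn's lemma there
  is a closed \<open>C \<subseteq> K\<close> minimal with \<open>[0,1] \<subseteq> f(C)\<close>, and minimality makes \<open>f\<close> map nowhere dense sets of
  the form \<open>C \<inter> cl(C \<inter> U) - U\<close> to nowhere dense sets. Therefore the sets that agree on \<open>C\<close> with an
  open set, up to a set with meagre image, form a \<open>\<sigma>\<close>-algebra and include all Borel sets. The preimage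
  of a Vitali set \<open>B \<subseteq> [0,1]\<close> is not among them: \<open>B\<close> is neither meagre nor comeagre in any
  interval.
\<close>

section \<open>Meagre sets and the Baire category theorem\<close>

text \<open>A cover by closed sets, rather than an equality with a union of nowhere dense sets,
  makes passing to subsets immediate and fits the Baire category theorem.\<close>

definition meagre :: "'a::topological_space set \<Rightarrow> bool"
  where "meagre S \<longleftrightarrow>
    (\<exists>\<G>. countable \<G> \<and> (\<forall>T\<in>\<G>. closed T \<and> interior T = {}) \<and> S \<subseteq> \<Union>\<G>)"

lemma meagre_subset: "meagre T \<Longrightarrow> S \<subseteq> T \<Longrightarrow> meagre S"
  unfolding meagre_def by (meson order_trans)

lemma meagre_nowhere_dense: "closed T \<Longrightarrow> interior T = {} \<Longrightarrow> meagre T"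
  unfolding meagre_def by (intro exI[of _ "{T}"]) auto

lemma meagre_empty: "meagre {}"
  by (simp add: meagre_nowhere_dense)

lemma meagre_UN:
  assumes "countable I" "\<And>i. i \<in> I \<Longrightarrow> meagre (S i)"
  shows "meagre (\<Union>i\<in>I. S i)"
proof -
  have "\<forall>i\<in>I. \<exists>\<G>. countable \<G> \<and> (\<forall>T\<in>\<G>. closed T \<and> interior T = {}) \<and> S i \<subseteq> \<Union>\<G>"
    using assms(2) by (simp add: meagre_def)
  from bchoice[OF this] obtain \<G> where
    \<G>: "\<forall>i\<in>I. countable (\<G> i) \<and> (\<forall>T\<in>\<G> i. closed T \<and> interior T = {}) \<and> S i \<subseteq> \<Union>(\<G> i)" ..
  show ?thesis
    unfolding meagre_def
  proof (intro exI[of _ "\<Union>i\<in>I. \<G> i"] conjI)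
    show "countable (\<Union>i\<in>I. \<G> i)"
      using \<G> by (intro countable_UN assms(1)) simp
    show "\<forall>T\<in>\<Union> (\<G> ` I). closed T \<and> interior T = {}"
      using \<G> by simp
    show "\<Union> (S ` I) \<subseteq> \<Union> (\<Union> (\<G> ` I))"
    proof
      fix x assume "x \<in> \<Union> (S ` I)"
      then obtain i where i: "i \<in> I" "x \<in> S i"
        by blast
      then have "x \<in> \<Union> (\<G> i)"
        using \<G> by (meson subsetD)
      then show "x \<in> \<Union> (\<Union> (\<G> ` I))"
        using i by blast
    qed
  qed
qed

lemma meagre_Un: "meagre S \<Longrightarrow> meagre T \<Longrightarrow> meagre (S \<union> T)"
  using meagre_UN[of "{True, False}" "\<lambda>b. if b then S else T"] by (simp add: Un_commute)

lemma meagre_translation: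
  fixes S :: "'a::real_normed_vector set"
  assumes "meagre S"
  shows "meagre ((+) a ` S)"
proof -
  obtain \<G> where \<G>: "countable \<G>" "\<forall>T\<in>\<G>. closed T \<and> interior T = {}" "S \<subseteq> \<Union>\<G>"
    using assms unfolding meagre_def by blast
  show ?thesis
    unfolding meagre_def
  proof (intro exI[of _ "(\<lambda>T. (+) a ` T) ` \<G>"] conjI)
    show "(+) a ` S \<subseteq> \<Union>((\<lambda>T. (+) a ` T) ` \<G>)"
      using \<G>(3) by blast
    show "\<forall>T\<in>(\<lambda>T. (+) a ` T) ` \<G>. closed T \<and> interior T = {}"
      using \<G>(2) by (auto simp: closed_translation interior_translation)
  qed (use \<G> in auto)
qed

lemma meagre_open_imp_empty:
  fixes V :: "'a::euclidean_space set"
  assumes "open V" "meagre V"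
  shows "V = {}"
proof -
  obtain \<G> where \<G>: "countable \<G>" "\<forall>T\<in>\<G>. closed T \<and> interior T = {}" "V \<subseteq> \<Union>\<G>"
    using assms unfolding meagre_def by blast
  have "euclidean interior_of \<Union>\<G> = {}"
    by (rule Baire_category_alt) (use \<G> in \<open>auto simp: completely_metrizable_space_euclidean\<close>)
  then show ?thesis
    using \<G>(3) assms(1) by (metis interior_of_maximal open_openin subset_empty)
qed

section \<open>A Vitali set, which lacks the Baire property\<close>

text \<open>Countably many rational translates of a Vitali set cover the line, so it is not meagre.
  Were it comeagre in a non-empty open set, it would meet its own translate by a small rational,
  giving two representatives of one coset.\<close>

lemma exists_set_without_Baire_property:
  obtains B :: "real set"
  where "B \<subseteq> {0..1}" "\<not> meagre B" "\<And>V. open V \<Longrightarrow> V \<noteq> {} \<Longrightarrow> \<not> meagre (V - B)"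
proof -
  \<comment> \<open>a Vitali set: one representative in \<open>[0,1]\<close> of each coset of \<open>\<rat>\<close>\<close>
  define rep :: "real \<Rightarrow> real" where "rep x = (SOME y. y \<in> {0..1} \<and> y - x \<in> \<rat>)" for x
  have rep: "rep x \<in> {0..1} \<and> rep x - x \<in> \<rat>" for x
  proof -
    have "frac x \<in> {0..1} \<and> frac x - x \<in> \<rat>"
      by (auto simp: frac_def frac_lt_1 less_imp_le) linarith+
    then show ?thesis
      unfolding rep_def by (rule someI)
  qed
  have rep_eq: "rep x = rep y" if "x - y \<in> \<rat>" for x y
  proof -
    have "z - x \<in> \<rat> \<longleftrightarrow> z - y \<in> \<rat>" for z
      using Rats_add[OF _ that, of "z - x"] Rats_diff[OF _ that, of "z - y"] by auto
    then show ?thesis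
      by (simp add: rep_def)
  qed
  define B where "B = range rep"
  have B_eq: "x = y" if xy: "x \<in> B" "y \<in> B" "x - y \<in> \<rat>" for x y
  proof -
    obtain u v where uv: "x = rep u" "y = rep v"
      using xy unfolding B_def by blast
    have "u - v = (x - y) - (x - u) + (y - v)"
      by simp
    also have "\<dots> \<in> \<rat>"
      using Rats_add[OF Rats_diff[OF xy(3)] ] rep[of u] rep[of v] uv by metis
    finally show ?thesis
      using rep_eq uv by simp
  qed
  show ?thesis
  proof
    show "B \<subseteq> {0..1}"
      using rep by (auto simp: B_def)
    show "\<not> meagre B"
    proof
      assume "meagre B"
      then have "meagre (\<Union>q\<in>\<rat>. (+) q ` B)"
        by (intro meagre_UN meagre_translation countable_rat)
      moreover have "(\<Union>q\<in>\<rat>. (+) q ` B) = UNIV"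
      proof (intro set_eqI iffI UNIV_I)
        fix x
        have "x = (x - rep x) + rep x" "x - rep x \<in> \<rat>"
          using Rats_minus_iff[of "rep x - x"] rep[of x] by auto
        then show "x \<in> (\<Union>q\<in>\<rat>. (+) q ` B)"
          unfolding B_def by blast
      qed
      ultimately show False
        using meagre_open_imp_empty[of "UNIV :: real set"] by simp
    qed
    fix V :: "real set"
    assume V: "open V" "V \<noteq> {}"
    show "\<not> meagre (V - B)"
    proof
      assume m: "meagre (V - B)"
      obtain x e where e: "e > 0" "ball x e \<subseteq> V"
        using V by (meson ex_in_conv openE)
      \<comment> \<open>As \<open>q\<close> is below the radius, \<open>x + q\<close> lies in both
        \<open>V\<close> and its translate.\<close>
      obtain q where q: "q \<in> \<rat>" "0 < q" "q < e"
        using Rats_dense_in_real[OF e(1)] by auto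
      have "x + q \<in> V \<inter> (+) q ` V"
        using e q by (auto simp: subset_iff dist_real_def)
      moreover have "open (V \<inter> (+) q ` V)"
        using V by (intro open_Int open_translation)
      \<comment> \<open>A point outside both sets on the right would be \<open>q + z\<close> with
        \<open>z\<close> and \<open>q + z\<close> in \<open>B\<close>, although \<open>q\<close> is
        a non-zero rational.\<close>
      moreover have "V \<inter> (+) q ` V \<subseteq> (V - B) \<union> (+) q ` (V - B)"
      proof -
        have False if "z \<in> B" "q + z \<in> B" for z
          using B_eq[of "q + z" z] that q by simp
        then show ?thesis
          by auto
      qed
      then have "meagre (V \<inter> (+) q ` V)"
        using meagre_subset meagre_Un m meagre_translation by metis
      ultimately show False
        using meagre_open_imp_empty by blast
    qed
  qed
qed

section \<open>Cantor schemes and a continuous map covering the unit interval\<close>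

text \<open>Greedy choice: a digit is set whenever the partial sum stays at most \<open>t\<close>.
  The error bound is non-strict, so \<open>t = 1\<close> is covered, with all digits one.\<close>

lemma binary_expansion_exists:
  fixes t :: real
  assumes "t \<in> {0..1}"
  obtains \<sigma> :: "nat \<Rightarrow> bool" where "(\<lambda>n. of_bool (\<sigma> n) / 2 ^ Suc n) sums t"
proof -
  define p :: "nat \<Rightarrow> real"
    where "p = rec_nat 0 (\<lambda>n r. r + of_bool (r + 1 / 2 ^ Suc n \<le> t) / 2 ^ Suc n)"
  define \<sigma> where "\<sigma> n \<longleftrightarrow> p n + 1 / 2 ^ Suc n \<le> t" for n
  have p0: "p 0 = 0" and pS: "p (Suc n) = p n + of_bool (\<sigma> n) / 2 ^ Suc n" for n
    by (simp_all add: p_def \<sigma>_def)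
  have bounds: "p n \<le> t \<and> t \<le> p n + 1 / 2 ^ n" for n
  proof (induction n)
    case 0
    then show ?case using assms by (simp add: p0)
  next
    case (Suc n)
    have "(1::real) / 2 ^ n = 1 / 2 ^ Suc n + 1 / 2 ^ Suc n"
      by simp
    then show ?case
      using Suc by (cases "\<sigma> n") (auto simp: pS \<sigma>_def simp del: power_Suc)
  qed
  have sum: "(\<Sum>k<n. of_bool (\<sigma> k) / 2 ^ Suc k) = p n" for n
    by (induction n) (simp_all add: p0 pS)
  have "(\<lambda>n. t - 1 / 2 ^ n) \<longlonglongrightarrow> t - 0"
    by (intro tendsto_intros LIMSEQ_divide_realpow_zero) auto
  then have "p \<longlonglongrightarrow> t"
    by (intro tendsto_sandwich[OF _ _ _ tendsto_const, of "\<lambda>n. t - 1 / 2 ^ n" p])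
      (use bounds in \<open>auto simp: algebra_simps\<close>)
  then show ?thesis
    by (intro that[of \<sigma>]) (simp add: sums_def sum del: power_Suc)
qed

text \<open>As no point of \<open>A\<close> is isolated, \<open>U\<close> contains two points of
  \<open>A\<close>. Disjoint open neighbourhoods of them shrink, by regularity, to closed ones
  inside \<open>U\<close>.\<close>

lemma compact_Hausdorff_split:
  assumes X: "compact_space X" "Hausdorff_space X"
    and A: "A \<subseteq> topspace X" "\<And>x. x \<in> A \<Longrightarrow> \<not> openin (subtopology X A) {x}"
    and U: "openin X U" "U \<inter> A \<noteq> {}"
  obtains U0 E0 U1 E1
  where "openin X U0" "closedin X E0" "U0 \<inter> A \<noteq> {}" "U0 \<subseteq> E0" "E0 \<subseteq> U"
    "openin X U1" "closedin X E1" "U1 \<inter> A \<noteq> {}" "U1 \<subseteq> E1" "E1 \<subseteq> U" "E0 \<inter> E1 = {}"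
proof -
  have nb: "neighbourhood_base_of (closedin X) X"
    using X compact_Hausdorff_imp_regular_space neighbourhood_base_of_closedin by blast
  obtain x where x: "x \<in> U" "x \<in> A"
    using U by blast
  have "openin (subtopology X A) (U \<inter> A)"
    using U by (auto simp: openin_subtopology)
  then have "U \<inter> A \<noteq> {x}"
    using A x by metis
  then obtain y where y: "y \<in> U" "y \<in> A" "y \<noteq> x"
    using x by blast
  obtain V W where VW: "openin X V" "openin X W" "x \<in> V" "y \<in> W" "disjnt V W"
    using X(2) x y A unfolding Hausdorff_space_def by (metis subsetD)
  obtain U0 E0 where 0: "openin X U0" "closedin X E0" "x \<in> U0" "U0 \<subseteq> E0" "E0 \<subseteq> U \<inter> V"
    using nb VW U x unfolding neighbourhood_base_of by (metis IntI openin_Int)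
  obtain U1 E1 where 1: "openin X U1" "closedin X E1" "y \<in> U1" "U1 \<subseteq> E1" "E1 \<subseteq> U \<inter> W"
    using nb VW U y unfolding neighbourhood_base_of by (metis IntI openin_Int)
  show ?thesis
    by (rule that[of U0 E0 U1 E1]) (use 0 1 x y VW in \<open>auto simp: disjnt_iff\<close>)
qed

lemma Cantor_scheme_exists:
  assumes X: "compact_space X" "Hausdorff_space X"
    and A: "A \<subseteq> topspace X" "A \<noteq> {}" "\<And>x. x \<in> A \<Longrightarrow> \<not> openin (subtopology X A) {x}"
  obtains E :: "bool list \<Rightarrow> 'a set"
  where "\<And>s. closedin X (E s)" "\<And>s. E s \<noteq> {}" "\<And>b s. E (b # s) \<subseteq> E s"
    "\<And>s. E (True # s) \<inter> E (False # s) = {}"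
proof -
  \<comment> \<open>The invariant of the recursion: an open subset that meets \<open>A\<close>
    allows a further split.\<close>
  define P where "P E \<longleftrightarrow> closedin X E \<and> (\<exists>U. openin X U \<and> U \<inter> A \<noteq> {} \<and> U \<subseteq> E)" for E
  have "\<exists>D. P (D True) \<and> P (D False) \<and> D True \<subseteq> E \<and> D False \<subseteq> E \<and> D True \<inter> D False = {}"
    if "P E" for E
  proof -
    obtain U where U: "openin X U" "U \<inter> A \<noteq> {}" "U \<subseteq> E"
      using \<open>P E\<close> unfolding P_def by blast
    obtain U0 E0 U1 E1
      where *: "openin X U0" "closedin X E0" "U0 \<inter> A \<noteq> {}" "U0 \<subseteq> E0" "E0 \<subseteq> U"
        "openin X U1" "closedin X E1" "U1 \<inter> A \<noteq> {}" "U1 \<subseteq> E1" "E1 \<subseteq> U" "E0 \<inter> E1 = {}"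
      using compact_Hausdorff_split[OF X A(1,3) U(1,2)] by metis
    have "P E0" "P E1"
      using * unfolding P_def by blast+
    then show ?thesis
      using * U by (intro exI[of _ "\<lambda>b. if b then E0 else E1"]) auto
  qed
  then obtain D where D: "\<And>E. P E \<Longrightarrow> P (D E True) \<and> P (D E False) \<and>
      D E True \<subseteq> E \<and> D E False \<subseteq> E \<and> D E True \<inter> D E False = {}"
    by metis
  \<comment> \<open>The head of the list is the latest choice; the tail indexes the parent.\<close>
  define E where "E = rec_list (topspace X) (\<lambda>b s F. D F b)"
  have E_Cons: "E (b # s) = D (E s) b" for b s
    by (simp add: E_def)
  have "P (E [])"
    using A unfolding E_def P_def by auto
  then have PE: "P (E s)" for s
  proof (induction s)
    case (Cons b s)
    then show ?case
      using D[of "E s"] by (cases b) (auto simp: E_Cons)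
  qed
  show ?thesis
  proof (rule that[of E])
    show "closedin X (E s)" "E s \<noteq> {}" for s
      using PE[of s] unfolding P_def by blast+
    show "E (b # s) \<subseteq> E s" for b s
      using D[OF PE[of s]] by (cases b) (auto simp: E_Cons)
    show "E (True # s) \<inter> E (False # s) = {}" for s
      using D[OF PE[of s]] by (auto simp: E_Cons)
  qed
qed

lemma continuous_map_suminf:
  fixes g :: "nat \<Rightarrow> 'a \<Rightarrow> real"
  assumes "\<And>n. continuous_map X euclideanreal (g n)"
    and "\<And>n x. x \<in> topspace X \<Longrightarrow> \<bar>g n x\<bar> \<le> M n" and "summable M"
  shows "continuous_map X euclideanreal (\<lambda>x. \<Sum>n. g n x)"
proof -
  have "uniform_limit (topspace X) (\<lambda>n x. \<Sum>i<n. g i x) (\<lambda>x. \<Sum>n. g n x) sequentially"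
    using assms by (intro Weierstrass_m_test) auto
  then have "continuous_map X Met_TC.mtopology (\<lambda>x. \<Sum>n. g n x)"
    by (intro Met_TC.continuous_map_uniform_limit[
          where F = sequentially and f = "\<lambda>n x. \<Sum>i<n. g i x"])
      (use assms(1) in \<open>auto simp: uniform_limit_iff intro!: continuous_map_sum always_eventually\<close>)
  then show ?thesis
    by simp
qed

text \<open>A Urysohn function \<open>g n\<close> reads choice number \<open>n\<close> of the Cantor
  scheme as a binary digit. The weighted sum of these takes the value \<open>t\<close> at any point
  on the branch given by the digits of \<open>t\<close>.\<close>

lemma continuous_map_onto_unit_interval:
  assumes X: "compact_space X" "Hausdorff_space X"
    and A: "A \<subseteq> topspace X" "A \<noteq> {}" "\<And>x. x \<in> A \<Longrightarrow> \<not> openin (subtopology X A) {x}"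
  obtains f where "continuous_map X euclideanreal f" "{0..1} \<subseteq> f ` topspace X"
proof -
  obtain E where E: "\<And>s. closedin X (E s)" "\<And>s. E s \<noteq> {}" "\<And>b s. E (b # s) \<subseteq> E s"
    "\<And>s. E (True # s) \<inter> E (False # s) = {}"
    using Cantor_scheme_exists[OF X A] by metis
  \<comment> \<open>The scheme only separates siblings; by nesting, disjoint parents have disjoint
    children.\<close>
  have disj: "E s \<inter> E t = {}" if "length s = length t" "s \<noteq> t" for s t
    using that
  proof (induction rule: list_induct2)
    case (Cons a s b t)
    then show ?case
      using E(3)[of a s] E(3)[of b t] E(4)[of s] by (cases a; cases b) auto
  qed auto
  \<comment> \<open>All pieces of level \<open>n + 1\<close> whose latest choice is
    \<open>b\<close>: finitely many, so the union is closed.\<close>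
  define F where "F b n = (\<Union>s\<in>{s. length s = n}. E (b # s))" for b n
  have fin: "finite {s :: bool list. length s = n}" for n
    using finite_lists_length_eq[of "UNIV :: bool set" n] by simp
  have F_closed: "closedin X (F b n)" for b n
    unfolding F_def using fin E(1) by (intro closedin_Union) auto
  have F_disj: "disjnt (F False n) (F True n)" for n
  proof -
    have "E (False # s) \<inter> E (True # t) = {}" if "length s = n" "length t = n" for s t
      using disj[of "False # s" "True # t"] that by simp
    then show ?thesis
      unfolding F_def disjnt_def by blast
  qed
  have "normal_space X"
    using X compact_Hausdorff_or_regular_imp_normal_space by blast
  have "\<exists>g. continuous_map X (top_of_set {0..1::real}) g \<and> g ` F False n \<subseteq> {0} \<and> g ` F True n \<subseteq> {1}"
    for n
    by (rule Urysohn_lemma[OF \<open>normal_space X\<close> F_closed F_closed F_disj zero_le_one]) blast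
  then obtain g where g: "\<And>n. continuous_map X (top_of_set {0..1::real}) (g n)"
    "\<And>n. g n ` F False n \<subseteq> {0}" "\<And>n. g n ` F True n \<subseteq> {1}"
    by metis
  have g_F: "g n x = of_bool b" if "x \<in> F b n" for n x b
    using that g(2,3)[of n] by (cases b) auto
  define f where "f x = (\<Sum>n. g n x / 2 ^ Suc n)" for x
  show ?thesis
  proof
    show "continuous_map X euclideanreal f"
      unfolding f_def
    proof (rule continuous_map_suminf)
      show "continuous_map X euclideanreal (\<lambda>x. g n x / 2 ^ Suc n)" for n
        using g(1)[of n] by (intro continuous_intros) (auto simp: continuous_map_in_subtopology)
      show "\<bar>g n x / 2 ^ Suc n\<bar> \<le> (1/2) ^ Suc n" if "x \<in> topspace X" for n x
        using g(1)[of n] that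
        by (auto simp: continuous_map_in_subtopology Pi_iff power_divide intro!: divide_right_mono)
      show "summable (\<lambda>n. (1/2::real) ^ Suc n)"
        by (intro summable_Suc_iff[THEN iffD2] summable_geometric) auto
    qed
    show "{0..1} \<subseteq> f ` topspace X"
    proof
      fix t :: real
      assume "t \<in> {0..1}"
      then obtain \<sigma> :: "nat \<Rightarrow> bool" where \<sigma>: "(\<lambda>n. of_bool (\<sigma> n) / 2 ^ Suc n) sums t"
        by (rule binary_expansion_exists)
      \<comment> \<open>Digits are prepended, so \<open>s n\<close> holds the first \<open>n\<close>
        digits in reverse order; digit \<open>n\<close> is decided at level
        \<open>Suc n\<close>.\<close>
      define s where "s = rec_nat [] (\<lambda>n. Cons (\<sigma> n))"
      have s_Suc: "s (Suc n) = \<sigma> n # s n" for n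
        by (simp add: s_def)
      have len: "length (s n) = n" for n
        by (induction n) (simp_all add: s_Suc, simp add: s_def)
      have "(\<Inter>n. E (s n)) \<noteq> {}"
        by (rule compact_space_imp_nest[OF X(1)])
          (use E(1,2) E(3)[THEN subsetD] in \<open>auto intro!: decseq_SucI simp: s_Suc\<close>)
      then obtain x where x: "\<And>n. x \<in> E (s n)"
        by blast
      have xF: "x \<in> F (\<sigma> n) n" for n
        unfolding F_def using x[of "Suc n"] len[of n] by (auto simp: s_Suc)
      have "f x = t"
        using \<sigma> by (simp add: f_def g_F[OF xF] sums_iff)
      moreover have "x \<in> topspace X"
        using x E(1) closedin_subset by blast
      ultimately show "t \<in> f ` topspace X"
        by blast
    qed
  qed
qed

section \<open>Irreducible maps\<close>

text \<open>The classical notion of an irreducible map, except that \<open>f\<close> may also take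
  values outside \<open>T\<close> on \<open>C\<close>.\<close>

definition irreducible_onto :: "'a topology \<Rightarrow> ('a \<Rightarrow> 'b) \<Rightarrow> 'b set \<Rightarrow> 'a set \<Rightarrow> bool"
  where "irreducible_onto X f T C \<longleftrightarrow> closedin X C \<and> T \<subseteq> f ` C \<and>
    (\<forall>D. closedin X D \<and> D \<subseteq> C \<and> T \<subseteq> f ` D \<longrightarrow> D = C)"

text \<open>Zorn's lemma applied to the open complements, where unions bound chains. For each
  \<open>t\<close> in \<open>T\<close>, the parts of its closed fibre outside the members of a chain
  have the finite intersection property, so by compactness some point over \<open>t\<close> avoids
  the whole union.\<close>

lemma irreducible_onto_exists:
  assumes X: "compact_space X" and f: "continuous_map X Y f" and Y: "t1_space Y"
    and T: "T \<subseteq> f ` topspace X"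
  obtains C where "irreducible_onto X f T C"
proof -
  define \<A> where "\<A> = {U. openin X U \<and> T \<subseteq> f ` (topspace X - U)}"
  have "\<exists>M\<in>\<A>. \<forall>U\<in>\<A>. M \<subseteq> U \<longrightarrow> U = M"
  proof (rule subset_Zorn_nonempty)
    show "\<A> \<noteq> {}"
      using T unfolding \<A>_def by (auto intro!: exI[of _ "{}"])
    fix \<C> assume ne: "\<C> \<noteq> {}" and ch: "subset.chain \<A> \<C>"
    have \<C>: "U \<in> \<A>" if "U \<in> \<C>" for U
      using ch that by (auto simp: subset_chain_def)
    have "t \<in> f ` (topspace X - \<Union>\<C>)" if t: "t \<in> T" for t
    proof -
      define S where "S U = {x \<in> topspace X. f x \<in> {t}} - U" for U
      have "t \<in> topspace Y"
        using t T f by (auto simp: continuous_map_def)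
      then have cl: "closedin X {x \<in> topspace X. f x \<in> {t}}"
        using Y by (intro closedin_continuous_map_preimage[OF f]) (auto simp: t1_space_closedin_singleton)
      have "\<Inter>(S ` \<C>) \<noteq> {}"
      proof (rule compact_space_fip[THEN iffD1, OF X, rule_format], intro conjI ballI allI impI)
        fix D assume "D \<in> S ` \<C>"
        then show "closedin X D"
          using cl \<C> by (auto simp: S_def \<A>_def intro!: closedin_diff)
      next
        fix \<F> assume "finite \<F> \<and> \<F> \<subseteq> S ` \<C>"
        then obtain \<D> where \<D>: "\<D> \<subseteq> \<C>" "finite \<D>" "\<F> = S ` \<D>"
          by (meson finite_subset_image)
        show "\<Inter>\<F> \<noteq> {}"
        proof (cases "\<D> = {}")
          case False
          have "subset.chain \<A> \<D>"
            using ch \<D>(1) unfolding subset_chain_def by (meson subsetD subset_trans)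
          then have "\<Union>\<D> \<in> \<A>"
            using Union_in_chain[OF \<D>(2) False] \<C> \<D> by blast
          then obtain x where "x \<in> topspace X - \<Union>\<D>" "f x = t"
            using t unfolding \<A>_def by blast
          then show ?thesis
            using \<D> by (auto simp: S_def)
        qed (use \<D> in simp)
      qed
      then show ?thesis
        using ne by (auto simp: S_def)
    qed
    then show "\<Union>\<C> \<in> \<A>"
      using \<C> by (auto simp: \<A>_def)
  qed
  then obtain M where M: "M \<in> \<A>" "\<And>U. U \<in> \<A> \<Longrightarrow> M \<subseteq> U \<Longrightarrow> U = M"
    by blast
  have "D = topspace X - M" if D: "closedin X D" "D \<subseteq> topspace X - M" "T \<subseteq> f ` D" for D
  proof -
    have sub: "D \<subseteq> topspace X" "M \<subseteq> topspace X"
      using D M(1) openin_subset unfolding \<A>_def by blast+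
    then have "topspace X - D = M"
      using D by (intro M(2)) (auto simp: \<A>_def double_diff)
    then show ?thesis
      using sub by blast
  qed
  then show ?thesis
    using M(1) by (intro that[of "topspace X - M"]) (auto simp: irreducible_onto_def \<A>_def)
qed

text \<open>The set in question is the boundary of \<open>C \<inter> U\<close> relative to
  \<open>C\<close>. If its image contained a non-empty open subset \<open>V\<close> of
  \<open>T\<close>, the part of \<open>C \<inter> U\<close> over \<open>V\<close> could be removed
  from \<open>C\<close> without uncovering \<open>T\<close>, against minimality.\<close>

lemma irreducible_onto_image_nowhere_dense:
  assumes C: "irreducible_onto X f T C" and f: "continuous_map X euclidean f"
    and U: "openin X U"
  shows "interior (f ` (C \<inter> X closure_of (C \<inter> U) - U) \<inter> T) = {}"
proof (rule ccontr)
  define N where "N = C \<inter> X closure_of (C \<inter> U) - U"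
  define V where "V = interior (f ` N \<inter> T)"
  assume "interior (f ` (C \<inter> X closure_of (C \<inter> U) - U) \<inter> T) \<noteq> {}"
  then obtain x where x: "x \<in> N" "f x \<in> V"
    unfolding V_def N_def[symmetric] using interior_subset by blast
  define P where "P = {y \<in> topspace X. f y \<in> V}"
  have "open V"
    unfolding V_def by (rule open_interior)
  then have P: "openin X P"
    using openin_continuous_map_preimage[OF f, of V] by (simp add: P_def)
  define W where "W = P \<inter> U"
  have W: "openin X W"
    using P U by (simp add: W_def openin_Int)
  \<comment> \<open>A boundary point is a limit of \<open>C \<inter> U\<close>, so its neighbourhood
    \<open>P\<close> meets \<open>C \<inter> U\<close>; hence removing \<open>W\<close> really
    shrinks \<open>C\<close>.\<close>
  have "x \<in> X closure_of (C \<inter> U)"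
    using x(1) by (simp add: N_def)
  moreover from this have "x \<in> P"
    using x(2) by (simp add: P_def in_closure_of)
  ultimately obtain y where y: "y \<in> C \<inter> U" "y \<in> P"
    using P unfolding in_closure_of by blast
  \<comment> \<open>the part of \<open>T\<close> lost with \<open>W\<close> lies in \<open>V\<close>, hence is still covered by \<open>N\<close>, which misses \<open>W\<close>\<close>
  have "T \<subseteq> f ` (C - W)"
  proof
    fix t assume t: "t \<in> T"
    show "t \<in> f ` (C - W)"
    proof (cases "t \<in> V")
      case True
      then have "t \<in> f ` N"
        using interior_subset unfolding V_def by blast
      then show ?thesis
        by (auto simp: N_def W_def)
    next
      case False
      then show ?thesis
        using t C by (auto simp: irreducible_onto_def W_def P_def)
    qed
  qed
  moreover have "closedin X (C - W)"
    using C W by (auto simp: irreducible_onto_def)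
  ultimately have "C - W = C"
    using C by (auto simp: irreducible_onto_def)
  then show False
    using y by (auto simp: W_def)
qed

section \<open>The Baire property of Borel sets, measured in the image\<close>

text \<open>Induction over the generated sigma-algebra: open sets have no error, countable unions
  collect the errors, and a complement adds the relative boundary of \<open>C \<inter> U\<close>,
  whose image is nowhere dense.\<close>

lemma irreducible_onto_Baire_property:
  fixes f :: "'a \<Rightarrow> 'b::t2_space"
  assumes X: "compact_space X" and f: "continuous_map X euclidean f" and T: "closed T"
    and C: "irreducible_onto X f T C" and A: "A \<in> Borel_sets_of X"
  obtains U where "openin X U" "meagre (f ` (C \<inter> (A - U \<union> (U - A))) \<inter> T)"
proof -
  have "\<exists>U. openin X U \<and> meagre (f ` (C \<inter> (A - U \<union> (U - A))) \<inter> T)"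
    using A unfolding Borel_sets_of_def
  proof (induction rule: sigma_sets.induct)
    case (Basic A)
    then show ?case
      by (intro exI[of _ A]) (simp add: meagre_empty)
  next
    case Empty
    then show ?case
      by (intro exI[of _ "{}"]) (simp add: meagre_empty)
  next
    case (Compl A)
    then obtain U where U: "openin X U" "meagre (f ` (C \<inter> (A - U \<union> (U - A))) \<inter> T)"
      by blast
    define N where "N = C \<inter> X closure_of (C \<inter> U) - U"
    have Ccl: "closedin X C"
      using C by (simp add: irreducible_onto_def)
    then have "closedin X N"
      using U unfolding N_def by (intro closedin_diff closedin_Int) auto
    \<comment> \<open>By compactness the image is closed, so empty interior of its part in
      \<open>T\<close> gives meagreness.\<close>
    then have "closed (f ` N)"
      using image_compactin[OF closedin_compact_space[OF X] f] compact_imp_closed by auto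
    then have N: "meagre (f ` N \<inter> T)"
      using irreducible_onto_image_nowhere_dense[OF C f U(1)] T
      by (intro meagre_nowhere_dense) (auto simp: N_def)
    \<comment> \<open>On \<open>C\<close>, this open set differs from the complement of
      \<open>U\<close> exactly by \<open>N\<close>.\<close>
    define U' where "U' = topspace X - X closure_of (C \<inter> U)"
    have "C \<inter> U \<subseteq> X closure_of (C \<inter> U)"
      using closedin_subset[OF Ccl] by (intro closure_of_subset) auto
    then have "C \<inter> (topspace X - A - U' \<union> (U' - (topspace X - A)))
        \<subseteq> C \<inter> (A - U \<union> (U - A)) \<union> N"
      by (auto simp: N_def U'_def)
    then have "meagre (f ` (C \<inter> (topspace X - A - U' \<union> (U' - (topspace X - A)))) \<inter> T)"
      by (intro meagre_subset[OF meagre_Un[OF U(2) N]]) blast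
    then show ?case
      by (intro exI[of _ U'] conjI) (auto simp: U'_def)
  next
    case (Union A)
    then obtain U where U: "\<And>i. openin X (U i)"
      "\<And>i. meagre (f ` (C \<inter> (A i - U i \<union> (U i - A i))) \<inter> T)"
      by metis
    have "meagre (\<Union>i. f ` (C \<inter> (A i - U i \<union> (U i - A i))) \<inter> T)"
      using U by (intro meagre_UN) auto
    then have "meagre (f ` (C \<inter> ((\<Union>i. A i) - (\<Union>i. U i) \<union> ((\<Union>i. U i) - (\<Union>i. A i)))) \<inter> T)"
      by (rule meagre_subset) blast
    then show ?case
      using U by (intro exI[of _ "\<Union>i. U i"]) auto
  qed
  then show ?thesis
    using that by blast
qed

section \<open>The preimage of a Vitali set is not Borel\<close>

theorem theorem3p3:
  fixes K :: "'a topology"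
  assumes "compact_space K" and "Hausdorff_space K"
    and "Borel_sets_of K = Pow (topspace K)"
  shows "scattered_space K"
proof (rule ccontr)
  assume "\<not> scattered_space K"
  then obtain A where A: "A \<subseteq> topspace K" "A \<noteq> {}" "\<And>x. x \<in> A \<Longrightarrow> \<not> openin (subtopology K A) {x}"
    unfolding scattered_space_def by blast
  obtain f where f: "continuous_map K euclideanreal f" "{0..1} \<subseteq> f ` topspace K"
    using continuous_map_onto_unit_interval[OF assms(1,2) A] by metis
  have "t1_space euclideanreal"
    by (simp add: Hausdorff_imp_t1_space)
  then obtain C where C: "irreducible_onto K f {0..1} C"
    using irreducible_onto_exists[OF assms(1) f(1) _ f(2)] by metis
  have Ccl: "closedin K C" and Cim: "{0..1} \<subseteq> f ` C"
    using C by (auto simp: irreducible_onto_def)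
  obtain B :: "real set"
    where B: "B \<subseteq> {0..1}" "\<not> meagre B" "\<And>V. open V \<Longrightarrow> V \<noteq> {} \<Longrightarrow> \<not> meagre (V - B)"
    using exists_set_without_Baire_property by metis
  define P where "P = {x \<in> topspace K. f x \<in> B}"
  have "P \<in> Borel_sets_of K"
    using assms(3) by (auto simp: P_def)
  then obtain U where U: "openin K U" "meagre (f ` (C \<inter> (P - U \<union> (U - P))) \<inter> {0..1})"
    using irreducible_onto_Baire_property[OF assms(1) f(1) _ C] by auto
  show False
  proof (cases "C \<inter> U = {}")
    case True
    \<comment> \<open>Here the error is all of \<open>C \<inter> P\<close>, whose image covers
      \<open>B\<close>.\<close>
    have "B \<subseteq> f ` (C \<inter> (P - U \<union> (U - P))) \<inter> {0..1}"
    proof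
      fix t assume "t \<in> B"
      moreover obtain x where "x \<in> C" "f x = t"
        using \<open>t \<in> B\<close> B(1) Cim by blast
      ultimately show "t \<in> f ` (C \<inter> (P - U \<union> (U - P))) \<inter> {0..1}"
        using True B(1) closedin_subset[OF Ccl] by (auto simp: P_def)
    qed
    then show False
      using B(2) U(2) meagre_subset by blast
  next
    case False
    \<comment> \<open>The points of the open interval whose fibre in \<open>C\<close> lies entirely
      in \<open>U\<close>. Irreducibility makes \<open>V\<close> non-empty, since
      \<open>C - U\<close> is a proper closed subset of \<open>C\<close>.\<close>
    define V where "V = {0<..<1} - f ` (C - U)"
    have D: "closedin K (C - U)"
      using Ccl U(1) by blast
    then have cl: "closed (f ` (C - U))"
      using image_compactin[OF closedin_compact_space[OF assms(1)] f(1)] compact_imp_closed by auto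
    have "V \<noteq> {}"
    proof
      assume "V = {}"
      then have "closure {0<..<1} \<subseteq> f ` (C - U)"
        using cl by (intro closure_minimal) (auto simp: V_def)
      then have "C - U = C"
        using C D by (auto simp: irreducible_onto_def)
      then show False
        using False by blast
    qed
    moreover have "open V"
      using cl by (auto simp: V_def)
    \<comment> \<open>Over a point of \<open>V\<close> outside \<open>B\<close>, the points of
      \<open>C\<close> lie in \<open>U\<close> but not in \<open>P\<close>, hence in the
      error.\<close>
    moreover have "V - B \<subseteq> f ` (C \<inter> (P - U \<union> (U - P))) \<inter> {0..1}"
    proof
      fix t assume t: "t \<in> V - B"
      then have "t \<in> {0..1}"
        by (auto simp: V_def)
      then obtain x where "x \<in> C" "f x = t"
        using Cim by blast
      then show "t \<in> f ` (C \<inter> (P - U \<union> (U - P))) \<inter> {0..1}"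
        using t by (auto simp: P_def V_def)
    qed
    ultimately show False
      using B(3) U(2) meagre_subset by blast
  qed
qed

end
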